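(* Let $f$, $\mathcal{D}$, $A$, $b$, $f^\epsilon$ and $\mathcal{F}$ be as in the context. Consider Nesterov's accelerated gradient algorithm (given in the context, in either its convex version or its strongly convex version) applied to the penalty function $f^\epsilon$ for an arbitrary $\epsilon>0$. If the algorithm is initialized at $y_0=x_0$, with $x_0$ belonging to the feasible set $\mathcal{F}$, then $x_k\in\mathcal{F}$ and $y_k\in\mathcal{F}$ for all $k\ge 0$.
   Context: Setting: the problem is $\min_{x\in\mathcal{D}} f(x)$ subject to $Ax-b=0$, where $f:\mathbb{R}^n\to\mathbb{R}$ is a twice continuously differentiable convex function; $\mathcal{D}\subset\mathbb{R}^n$ is a convex compact set that is regular, i.e. equal to the closure of its interior; $A\in\mathbb{R}^{p\times n}$ has full row rank, $p<n$, and $b\in\mathbb{R}^p$. The feasible set is $\mathcal{F}=\{x\in\mathcal{D} : Ax-b=0\}$. Penalty function: for $\epsilon>0$, $$f^\epsilon(x)=f(x)-\big([AA^\top]^{-1}A\nabla f(x)\big)^\top(Ax-b)+\frac1\epsilon\|Ax-b\|^2 ,$$ with gradient $$\nabla f^\epsilon(x)=\nabla f(x)-\nabla^2 f(x)A^\top[AA^\top]^{-1}(Ax-b)-A^\top[AA^\top]^{-1}A\nabla f(x)+\frac2\epsilon A^\top(Ax-b).$$ Nesterov's algorithm, where $\alpha>0$ is the stepsize. Convex version (with $a_0=1$): $$x_{k+1}=y_k-\alpha\nabla f^\epsilon(y_k),\quad a_{k+1}=\frac{1+\sqrt{4a_k^2+1}}{2},\quad y_{k+1}=x_{k+1}+\frac{a_k-1}{a_{k+1}}(x_{k+1}-x_k).$$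 Strongly convex version (used when $f^\epsilon$ is strongly convex with parameter $s>0$ and has Lipschitz gradient with constant $L$): $$x_{k+1}=y_k-\alpha\nabla f^\epsilon(y_k),\quad y_{k+1}=x_{k+1}+\frac{\sqrt L-\sqrt s}{\sqrt L+\sqrt s}(x_{k+1}-x_k).$$
   Formalization: Since the steps are not projected onto D, iterates can leave D and the literal claim fails; what is proved is that Ax_k=b and Ay_k=b for all k, and that x_k (resp. y_k) belongs to F whenever it lies in D. *)

theory Defs
  imports "HOL-Analysis.Analysis"
begin

definition grad :: "('a::real_inner \<Rightarrow> real) \<Rightarrow> 'a \<Rightarrow> 'a" where
  "grad f x = (THE g. GDERIV f x :> g)"

definition hessian :: "(real^'n \<Rightarrow> real) \<Rightarrow> real^'n \<Rightarrow> real^'n^'n" where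
  "hessian f x = matrix (frechet_derivative (grad f) (at x))"

definition twice_continuously_differentiable :: "(real^'n \<Rightarrow> real) \<Rightarrow> bool" where
  "twice_continuously_differentiable f \<longleftrightarrow>
     (\<forall>x. f differentiable (at x)) \<and>
     (\<forall>x. grad f differentiable (at x)) \<and>
     continuous_on UNIV (hessian f)"

definition regular_set :: "'a::topological_space set \<Rightarrow> bool" where
  "regular_set D \<longleftrightarrow> D = closure (interior D)"

(* Nesterov's steps are not projected onto D, so starting in the feasible set does not
   keep the iterates in D: only the affine constraint is invariant. *)
definition feasible_set :: "(real^'n) set \<Rightarrow> real^'n^'p \<Rightarrow> real^'p \<Rightarrow> (real^'n) set" where
  "feasible_set D A b = {x \<in> D. A *v x - b = 0}"

definition penalty ::
  "(real^'n \<Rightarrow> real) \<Rightarrow> real^'n^'p \<Rightarrow> real^'p \<Rightarrow> real \<Rightarrow> real^'n \<Rightarrow> real" where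
  "penalty f A b \<epsilon> x =
     f x
     - (matrix_inv (A ** transpose A) *v (A *v grad f x)) \<bullet> (A *v x - b)
     + 1 / \<epsilon> * (norm (A *v x - b))\<^sup>2"

definition strongly_convex_on :: "'a::real_normed_vector set \<Rightarrow> real \<Rightarrow> ('a \<Rightarrow> real) \<Rightarrow> bool" where
  "strongly_convex_on S s f \<longleftrightarrow> convex S \<and>
     (\<forall>x\<in>S. \<forall>y\<in>S. \<forall>t\<in>{0..1}.
        f (t *\<^sub>R x + (1 - t) *\<^sub>R y)
          \<le> t * f x + (1 - t) * f y - s / 2 * t * (1 - t) * (norm (x - y))\<^sup>2)"

definition nesterov_convex ::
  "('a::real_inner \<Rightarrow> real) \<Rightarrow> real \<Rightarrow> (nat \<Rightarrow> 'a) \<Rightarrow> (nat \<Rightarrow> 'a) \<Rightarrow> bool" where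
  "nesterov_convex g \<alpha> x y \<longleftrightarrow>
     (\<exists>a :: nat \<Rightarrow> real. a 0 = 1 \<and>
       (\<forall>k. x (Suc k) = y k - \<alpha> *\<^sub>R grad g (y k) \<and>
            a (Suc k) = (1 + sqrt (4 * (a k)\<^sup>2 + 1)) / 2 \<and>
            y (Suc k) = x (Suc k) + ((a k - 1) / a (Suc k)) *\<^sub>R (x (Suc k) - x k)))"

definition nesterov_strongly_convex ::
  "('a::real_inner \<Rightarrow> real) \<Rightarrow> real \<Rightarrow> real \<Rightarrow> real \<Rightarrow> (nat \<Rightarrow> 'a) \<Rightarrow> (nat \<Rightarrow> 'a) \<Rightarrow> bool" where
  "nesterov_strongly_convex g s L \<alpha> x y \<longleftrightarrow>
     (\<forall>k. x (Suc k) = y k - \<alpha> *\<^sub>R grad g (y k) \<and>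
          y (Suc k) = x (Suc k) +
            ((sqrt L - sqrt s) / (sqrt L + sqrt s)) *\<^sub>R (x (Suc k) - x k))"

end

theory Submission
  imports Defs
begin

text \<open>
  The reason for the invariance is that on the affine set \<open>A x = b\<close> the gradient of the penalty
  function is tangent to that set. At a point with \<open>A x = b\<close> every term of the derivative that
  carries the residual \<open>A x - b\<close> as a factor vanishes: the quadratic penalty contributes nothing,
  and in the product rule for the multiplier term only the derivative of the residual
  survives, so the Hessian of \<open>f\<close> disappears. What remains is
  \<open>\<nabla>f(x) - A\<^sup>T (A A\<^sup>T)\<^sup>-\<^sup>1 A \<nabla>f(x)\<close> (\<open>grad_penalty_on_constraint\<close>), the orthogonal projection of
  \<open>\<nabla>f(x)\<close> onto the kernel of \<open>A\<close>; full row rank makes \<open>A A\<^sup>T\<close> invertible, and then \<open>A\<close> annihilates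
  this vector (\<open>grad_penalty_tangent\<close>).

  A gradient step therefore stays in the affine set for any stepsize, and the extrapolation step is
  an affine combination of two of its points. Both versions of the algorithm differ only in the
  extrapolation weights, which may be arbitrary reals (\<open>momentum_iterates_invariant\<close>).
\<close>

section \<open>Gradients\<close>

lemma grad_eqI:
  assumes "GDERIV f x :> g"
  shows "grad f x = g"
  unfolding grad_def
proof (rule the_equality)
  show "GDERIV f x :> g" by (rule assms)
next
  fix g' assume "GDERIV f x :> g'"
  then have "(\<lambda>h. h \<bullet> g') = (\<lambda>h. h \<bullet> g)"
    using assms unfolding gderiv_def by (rule has_derivative_unique)
  then show "g' = g"
    by (metis vector_eq_ldot)
qed

text \<open>In finite dimension the derivative is represented by the adjoint applied to \<open>1\<close>.\<close>

lemma GDERIV_grad: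
  fixes f :: "'a::euclidean_space \<Rightarrow> real"
  assumes "f differentiable (at x)"
  shows "GDERIV f x :> grad f x"
proof -
  obtain f' where f': "(f has_derivative f') (at x)"
    using assms by (auto simp: differentiable_def)
  then have "linear f'"
    by (rule has_derivative_linear)
  then have "f' = (\<lambda>h. h \<bullet> adjoint f' 1)"
    by (simp add: adjoint_works)
  with f' have "GDERIV f x :> adjoint f' 1"
    unfolding gderiv_def by simp
  then show ?thesis
    by (simp add: grad_eqI)
qed

section \<open>The penalty function on the constraint set\<close>

text \<open>The kernel of the Gram matrix \<open>A A\<^sup>T\<close> is that of \<open>A\<^sup>T\<close>, because
  \<open>v \<bullet> (A A\<^sup>T v) = \<parallel>A\<^sup>T v\<parallel>\<^sup>2\<close>.\<close>

lemma invertible_mult_transpose: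
  fixes A :: "real^'n^'p"
  assumes "rank A = CARD('p)"
  shows "invertible (A ** transpose A)"
proof -
  have inj: "inj ((*v) (transpose A))"
    using assms by (simp add: rank_transpose flip: full_rank_injective)
  have "v = 0" if "(A ** transpose A) *v v = 0" for v
  proof -
    have "(transpose A *v v) \<bullet> (transpose A *v v) = v \<bullet> ((A ** transpose A) *v v)"
      by (simp add: dot_lmul_matrix vector_transpose_matrix flip: matrix_vector_mul_assoc)
    then have "transpose A *v v = transpose A *v 0"
      using that by simp
    with inj show "v = 0"
      by (rule injD)
  qed
  then show ?thesis
    by (simp add: invertible_left_inverse matrix_left_invertible_ker)
qed

lemma matrix_inv_right_inverse:
  fixes B :: "'a::semiring_1^'n^'m"
  assumes "invertible B"
  shows "B ** matrix_inv B = mat 1"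
  using someI_ex[OF assms[unfolded invertible_def]] by (simp add: matrix_inv_def)

lemma grad_penalty_on_constraint:
  fixes f :: "real^'n \<Rightarrow> real" and A :: "real^'n^'p"
  assumes f: "f differentiable (at x)" and g: "grad f differentiable (at x)"
    and x: "A *v x = b"
  shows "grad (penalty f A b \<epsilon>) x =
    grad f x - transpose A *v (matrix_inv (A ** transpose A) *v (A *v grad f x))"
proof -
  define M where "M = matrix_inv (A ** transpose A)"
  obtain g' where g': "(grad f has_derivative g') (at x)"
    using g by (auto simp: differentiable_def)
  have mult: "((\<lambda>z. M *v (A *v grad f z)) has_derivative (\<lambda>v. M *v (A *v g' v))) (at x)"
    by (intro bounded_linear.has_derivative[OF matrix_vector_mul_bounded_linear] g')
  have res: "((\<lambda>z. A *v z - b) has_derivative (\<lambda>v. A *v v)) (at x)"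
    by (auto intro!: derivative_eq_intros
        bounded_linear_imp_has_derivative matrix_vector_mul_bounded_linear)
  have df: "(f has_derivative (\<lambda>v. v \<bullet> grad f x)) (at x)"
    using GDERIV_grad[OF f] by (simp add: gderiv_def)
  have "(penalty f A b \<epsilon> has_derivative
      (\<lambda>v. v \<bullet> grad f x
         - ((M *v (A *v grad f x)) \<bullet> (A *v v) + (M *v (A *v g' v)) \<bullet> (A *v x - b))
         + 1 / \<epsilon> * ((A *v x - b) \<bullet> (A *v v) + (A *v v) \<bullet> (A *v x - b)))) (at x)"
    unfolding penalty_def[abs_def] power2_norm_eq_inner M_def[symmetric]
    by (intro has_derivative_add has_derivative_diff has_derivative_mult_right
        has_derivative_inner df mult res)
  moreover have "u \<bullet> (A *v v) = v \<bullet> (transpose A *v u)" for u v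
    by (simp add: dot_lmul_matrix[symmetric] inner_commute)
  ultimately have "GDERIV (penalty f A b \<epsilon>) x :>
      grad f x - transpose A *v (M *v (A *v grad f x))"
    unfolding gderiv_def by (simp add: x inner_diff_right)
  then show ?thesis
    unfolding M_def by (rule grad_eqI)
qed

lemma grad_penalty_tangent:
  fixes f :: "real^'n \<Rightarrow> real" and A :: "real^'n^'p"
  assumes "f differentiable (at x)" and "grad f differentiable (at x)"
    and "rank A = CARD('p)" and "A *v x = b"
  shows "A *v grad (penalty f A b \<epsilon>) x = 0"
proof -
  have "(A ** transpose A) ** matrix_inv (A ** transpose A) = mat 1"
    by (rule matrix_inv_right_inverse[OF invertible_mult_transpose[OF assms(3)]])
  then have "A *v (transpose A *v (matrix_inv (A ** transpose A) *v w)) = w" for w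
    by (metis matrix_vector_mul_assoc matrix_vector_mul_lid)
  then show ?thesis
    using assms by (simp add: grad_penalty_on_constraint matrix_vector_mult_diff_distrib)
qed

section \<open>Invariance under gradient steps with momentum\<close>

text \<open>Common form of both versions of the algorithm, with weights \<open>\<beta>\<close> and descent direction \<open>d\<close>.
  The claims for \<open>x\<close> and \<open>y\<close> need a joint induction since each extrapolation uses both sequences.\<close>

lemma momentum_iterates_invariant:
  fixes A :: "real^'n^'p" and x y :: "nat \<Rightarrow> real^'n"
  assumes tangent: "\<And>z. A *v z = b \<Longrightarrow> A *v d z = 0"
    and x_step: "\<And>k. x (Suc k) = y k - \<alpha> *\<^sub>R d (y k)"
    and y_step: "\<And>k. y (Suc k) = x (Suc k) + \<beta> k *\<^sub>R (x (Suc k) - x k)"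
    and init: "A *v x 0 = b" "y 0 = x 0"
  shows "A *v x k = b \<and> A *v y k = b"
proof (induction k)
  case 0
  show ?case using init by simp
next
  case (Suc k)
  then have "A *v x (Suc k) = b"
    by (simp add: x_step tangent matrix_vector_mult_diff_distrib matrix_vector_mult_scaleR)
  moreover from this Suc have "A *v y (Suc k) = b"
    unfolding y_step[of k]
    by (simp add: matrix_vector_mult_diff_distrib matrix_vector_right_distrib
        matrix_vector_mult_scaleR)
  ultimately show ?case ..
qed

theorem mainTheorem3:
  fixes f :: "real^'n \<Rightarrow> real" and D :: "(real^'n) set"
    and A :: "real^'n^'p" and b :: "real^'p"
    and \<epsilon> \<alpha> :: real and x y :: "nat \<Rightarrow> real^'n"
  assumes "twice_continuously_differentiable f"
    and "convex_on UNIV f"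
    and "convex D" and "compact D" and "regular_set D"
    and "rank A = CARD('p)" and "CARD('p) < CARD('n)"
    and "\<epsilon> > 0" and "\<alpha> > 0"
    and "nesterov_convex (penalty f A b \<epsilon>) \<alpha> x y \<or>
         (\<exists>s L. s > 0 \<and> strongly_convex_on D s (penalty f A b \<epsilon>) \<and>
                L-lipschitz_on D (grad (penalty f A b \<epsilon>)) \<and>
                nesterov_strongly_convex (penalty f A b \<epsilon>) s L \<alpha> x y)"
    and "y 0 = x 0" and "x 0 \<in> feasible_set D A b"
  shows "\<forall>k. A *v x k - b = 0 \<and> A *v y k - b = 0 \<and>
             (x k \<in> D \<longrightarrow> x k \<in> feasible_set D A b) \<and>
             (y k \<in> D \<longrightarrow> y k \<in> feasible_set D A b)"
proof -
  let ?d = "grad (penalty f A b \<epsilon>)"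
  have tangent: "A *v ?d z = 0" if "A *v z = b" for z
    using assms(1,6) that
    by (simp add: twice_continuously_differentiable_def grad_penalty_tangent)
  obtain \<beta> where
    x_step: "\<And>k. x (Suc k) = y k - \<alpha> *\<^sub>R ?d (y k)" and
    y_step: "\<And>k. y (Suc k) = x (Suc k) + \<beta> k *\<^sub>R (x (Suc k) - x k)"
    using assms(10)
  proof (elim disjE exE conjE)
    assume "nesterov_convex (penalty f A b \<epsilon>) \<alpha> x y"
    then obtain a :: "nat \<Rightarrow> real" where
      "\<And>k. x (Suc k) = y k - \<alpha> *\<^sub>R ?d (y k)"
      "\<And>k. y (Suc k) = x (Suc k) + ((a k - 1) / a (Suc k)) *\<^sub>R (x (Suc k) - x k)"
      unfolding nesterov_convex_def by blast
    then show thesis by (rule that)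
  next
    fix s L
    assume "nesterov_strongly_convex (penalty f A b \<epsilon>) s L \<alpha> x y"
    then have
      "\<And>k. x (Suc k) = y k - \<alpha> *\<^sub>R ?d (y k)"
      "\<And>k. y (Suc k) = x (Suc k) +
         ((sqrt L - sqrt s) / (sqrt L + sqrt s)) *\<^sub>R (x (Suc k) - x k)"
      unfolding nesterov_strongly_convex_def by blast+
    then show thesis by (rule that)
  qed
  have "A *v x 0 = b"
    using assms(12) by (simp add: feasible_set_def)
  then have "A *v x k = b \<and> A *v y k = b" for k
    using tangent x_step y_step assms(11)
    by (intro momentum_iterates_invariant[where d = ?d and \<alpha> = \<alpha> and \<beta> = \<beta>])
  then show ?thesis
    by (simp add: feasible_set_def)
qed

end
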